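(* Let $q\ge3$ be odd. For any $0<a<\frac{1}{B_q}$, let $\tilde E_q=2\sqrt{1-a^2B_q^2}$. Suppose $E\in S_q$ and $E\in(-2,-\tilde E_q)\cup(\tilde E_q,2)$. Then for any $\theta\in[0,\pi]$, there exist potentials $V:\mathbb{N}\to\mathbb{R}$ such that $\limsup_{n\to\infty}|nV(n)|=a$ and the associated Schrödinger operator $H=H_0+V$ with boundary condition $\frac{u(1)}{u(0)}=\tan\theta$ has eigenvalue $E$.
   Context: Here $\mathbb{N}=\{1,2,\dots\}$. The half-line discrete Schrödinger operator $H=H_0+V$ with boundary condition $\theta\in[0,\pi]$ is given by $(Hu)(n)=u(n+1)+u(n-1)+V(n)u(n)$ for $n\ge 1$, with $\frac{u(1)}{u(0)}=\tan\theta$ (i.e. $u(1)\cos\theta=u(0)\sin\theta$). A number $E$ is an eigenvalue if there is a nontrivial solution $u$ of $u(n+1)+u(n-1)+V(n)u(n)=Eu(n)$ ($n\ge1$) satisfying the boundary condition with $u\in\ell^2(\mathbb{N})$. For $E\in(-2,2)$, $k(E)\in(0,1)$ is defined by $E=2\cos\pi k(E)$. For an integer $q\ge2$, $S_q=\{E\in(-2,2): k(E)=p/q \text{ for some } p\in\{1,\dots,q-1\} \text{ with } \gcd(p,q)=1\}$. For odd $q\ge3$, $B_q=\frac{1+\cos(\pi/q)}{q\sin(\pi/q)}$. *)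

theory Defs
  imports "HOL-Analysis.Analysis"
begin

(* The half-line is {1,2,...}.  Sequences u live on nat because the equation at
   n = 1 involves the boundary value u 0; the value V 0 is never used. *)

definition schroedinger :: "(nat \<Rightarrow> real) \<Rightarrow> (nat \<Rightarrow> complex) \<Rightarrow> nat \<Rightarrow> complex" where
  "schroedinger V u n = u (n + 1) + u (n - 1) + of_real (V n) * u n"

(* u 1 / u 0 = tan \<theta>, in the division-free form that also covers \<theta> = pi/2. *)
definition boundary_condition :: "real \<Rightarrow> (nat \<Rightarrow> complex) \<Rightarrow> bool" where
  "boundary_condition \<theta> u \<longleftrightarrow> u 1 * of_real (cos \<theta>) = u 0 * of_real (sin \<theta>)"

definition square_summable :: "(nat \<Rightarrow> complex) \<Rightarrow> bool" where
  "square_summable u \<longleftrightarrow> (\<lambda>n. (cmod (u n))\<^sup>2) summable_on {1..}"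

definition is_eigenvalue :: "(nat \<Rightarrow> real) \<Rightarrow> real \<Rightarrow> real \<Rightarrow> bool" where
  "is_eigenvalue V \<theta> E \<longleftrightarrow>
     (\<exists>u. (\<exists>n. u n \<noteq> 0) \<and> (\<forall>n\<ge>1. schroedinger V u n = of_real E * u n) \<and>
          boundary_condition \<theta> u \<and> square_summable u)"

definition quasimomentum :: "real \<Rightarrow> real" where
  "quasimomentum E = (THE k. 0 < k \<and> k < 1 \<and> E = 2 * cos (pi * k))"

lemma quasimomentum_unique:
  assumes "-2 < E" "E < 2"
  shows "\<exists>!k. 0 < k \<and> k < 1 \<and> E = 2 * cos (pi * k)"
proof (rule ex1I[of _ "arccos (E / 2) / pi"])
  have "0 < arccos (E / 2)" "arccos (E / 2) < pi"
    using assms arccos_lt_bounded[of "E / 2"] by auto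
  then show "0 < arccos (E / 2) / pi \<and> arccos (E / 2) / pi < 1 \<and>
      E = 2 * cos (pi * (arccos (E / 2) / pi))"
    using assms by (simp add: cos_arccos)
next
  fix k :: real
  assume k: "0 < k \<and> k < 1 \<and> E = 2 * cos (pi * k)"
  then have "arccos (E / 2) = pi * k"
    by (simp add: arccos_cos)
  then show "k = arccos (E / 2) / pi"
    by simp
qed

definition S_set :: "nat \<Rightarrow> real set" where
  "S_set q = {E. -2 < E \<and> E < 2 \<and>
     (\<exists>p\<in>{1..q - 1}. coprime p q \<and> quasimomentum E = real p / real q)}"

definition B_const :: "nat \<Rightarrow> real" where
  "B_const q = (1 + cos (pi / real q)) / (real q * sin (pi / real q))"

definition E_tilde :: "real \<Rightarrow> nat \<Rightarrow> real" where
  "E_tilde a q = 2 * sqrt (1 - a\<^sup>2 * (B_const q)\<^sup>2)"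

end

theory Submission
  imports Defs
begin

text \<open>
  Write \<open>E = 2 cos \<omega>\<close> with \<open>\<omega> = \<pi> p / q\<close>. In the complex coordinate
  \<open>y n = cis \<omega> * (u n - cis (-\<omega>) * u (n - 1))\<close>, whose imaginary part is \<open>sin \<omega> * u n\<close>, one step
  of the free equation is rotation by \<open>\<omega>\<close>, and a potential \<open>V n\<close> adds a shear that changes
  \<open>\<bar>y\<bar>\<^sup>2\<close> by \<open>- (V n / sin \<omega>) * Im (y\<^sup>2)\<close> to first order. The potential
  \<open>V n = (a / n) * sg (Im ((y n)\<^sup>2))\<close> with a sign \<open>sg = \<plusminus>1\<close>, built recursively along the solution that satisfies
  the boundary condition, therefore has \<open>\<bar>n V n\<bar> = a\<close> for every \<open>n \<ge> 1\<close> and makes every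
  first-order term a loss.

  It remains to see that the losses suffice for square summability. Up to errors of relative
  size \<open>O(1 / m\<^sup>2)\<close>, the loss over the \<open>q\<close> steps starting at \<open>m\<close> is
  \<open>a / (m sin \<omega>)\<close> times the sum of \<open>\<bar>Im (y\<^sup>2)\<bar>\<close> over \<open>q\<close> freely rotated copies of \<open>y\<close>
  (\<open>phasor_block_loss\<close>). As \<open>q\<close> is odd, the doubled phases of these copies are equidistributed
  modulo \<open>\<pi>\<close> with spacing \<open>\<pi> / q\<close>; whatever the initial phase, the absolute sines of such
  phases add up to at least \<open>cot (\<pi> / 2q) = q B\<close>, where \<open>B\<close> is \<open>B_const q\<close> (\<open>sum_abs_sin_ge\<close>).
  So \<open>\<bar>y\<bar>\<^sup>2\<close> shrinks by a factor \<open>1 - \<gamma> q / m + O(1 / m\<^sup>2)\<close> from \<open>m\<close> to \<open>m + q\<close>, where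
  \<open>\<gamma> = a B / sin \<omega>\<close>. The condition on \<open>E\<close> says exactly that \<open>\<gamma> > 1\<close>, and then a Raabe test
  with step \<open>q\<close> (\<open>summable_raabe_step\<close>) gives \<open>\<Sum> \<bar>y\<bar>\<^sup>2 < \<infinity>\<close>.
\<close>

section \<open>Equidistributed phases\<close>

lemma abs_sin_add_int_pi: "\<bar>sin (x + pi * of_int k)\<bar> = \<bar>sin x\<bar>"
proof -
  have s: "sin (pi * of_int k) = 0"
    by (metis mult.commute sin_zero_iff_int2)
  then have "\<bar>cos (pi * of_int k)\<bar> = 1"
    by (simp add: abs_square_eq_1[symmetric] cos_squared_eq)
  with s show ?thesis
    by (simp add: sin_add abs_mult)
qed

lemma bij_betw_affine_mod:
  fixes q b k :: int
  assumes "q > 0" and "coprime b q"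
  shows "bij_betw (\<lambda>j. (b * j + k) mod q) {0..<q} {0..<q}"
proof -
  have inj: "inj_on (\<lambda>j. (b * j + k) mod q) {0..<q}"
  proof (rule inj_onI)
    fix i j assume ij: "i \<in> {0..<q}" "j \<in> {0..<q}"
      and "(b * i + k) mod q = (b * j + k) mod q"
    then have "q dvd (b * i + k) - (b * j + k)"
      by (simp only: mod_eq_dvd_iff)
    then have "q dvd b * (i - j)"
      by (simp add: algebra_simps)
    then have "q dvd i - j"
      using assms(2) by (simp add: coprime_commute coprime_dvd_mult_right_iff)
    then have "i mod q = j mod q"
      by (simp add: mod_eq_dvd_iff)
    then show "i = j" using ij by simp
  qed
  moreover have "(\<lambda>j. (b * j + k) mod q) ` {0..<q} \<subseteq> {0..<q}"
    using assms(1) by auto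
  ultimately show ?thesis
    by (simp add: bij_betw_def endo_inj_surj)
qed

text \<open>
  Multiplication by the sine of the half step turns each term into half the difference of two
  consecutive cosines, so the sum telescopes; the two end points differ by \<open>\<pi>\<close>.
\<close>

lemma sum_sin_half_period:
  assumes "q > 0"
  shows "sin (pi / (2 * real q)) * (\<Sum>l<q. sin (x + pi * real l / real q))
         = cos (x - pi / (2 * real q))"
proof -
  define h where "h = pi / (2 * real q)"
  define f where "f = (\<lambda>l::nat. cos (x + (2 * real l - 1) * h))"
  have "sin h * sin (x + pi * real l / real q) = (f l - f (Suc l)) / 2" for l
  proof -
    have "pi * real l / real q = 2 * real l * h"
      using assms by (simp add: h_def field_simps)
    moreover have "f l = cos ((x + 2 * real l * h) - h)" "f (Suc l) = cos ((x + 2 * real l * h) + h)"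
      by (simp_all add: f_def algebra_simps)
    ultimately show ?thesis
      by (simp add: cos_diff cos_add)
  qed
  then have "sin h * (\<Sum>l<q. sin (x + pi * real l / real q)) = (\<Sum>l<q. f l - f (Suc l)) / 2"
    unfolding sum_distrib_left sum_divide_distrib by (intro sum.cong refl)
  also have "\<dots> = (f 0 - f q) / 2"
    by (simp add: sum_lessThan_telescope')
  also have "f q = - f 0"
  proof -
    have "x + (2 * real q - 1) * h = (x - h) + pi"
      using assms by (simp add: h_def field_simps)
    then have "f q = cos ((x - h) + pi)" unfolding f_def by (rule arg_cong)
    then show ?thesis by (simp add: f_def)
  qed
  finally show ?thesis by (simp add: f_def h_def)
qed

lemma B_const_eq_cot:
  assumes "q \<ge> 2"
  shows "real q * B_const q = cot (pi / (2 * real q))"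
proof -
  define h where "h = pi / (2 * real q)"
  have h: "pi / real q = 2 * h" by (simp add: h_def)
  have "0 < h" "h < pi / 2"
    using assms by (auto simp: h_def field_simps)
  then have "sin h > 0" "cos h > 0"
    by (auto intro!: sin_gt_zero cos_gt_zero)
  then have "(1 + cos (2 * h)) / sin (2 * h) = cos h / sin h"
    by (simp add: cos_double_cos sin_double power2_eq_square)
  moreover have "real q * B_const q = (1 + cos (2 * h)) / sin (2 * h)"
    using assms by (simp add: B_const_def h)
  ultimately show ?thesis
    by (simp add: h_def cot_def)
qed

lemma B_const_pos:
  assumes "q \<ge> 2"
  shows "B_const q > 0"
proof -
  have "0 < pi / real q" "pi / real q \<le> pi / 2"
    using assms by (auto simp: field_simps)
  moreover from this have "pi / real q < pi"
    using pi_gt_zero by linarith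
  ultimately have "sin (pi / real q) > 0" "cos (pi / real q) \<ge> 0"
    by (auto intro!: sin_gt_zero cos_ge_zero)
  then show ?thesis
    using assms by (auto simp: B_const_def intro!: divide_pos_pos mult_pos_pos add_pos_nonneg)
qed

text \<open>
  The function \<open>\<bar>sin\<bar>\<close> has period \<open>\<pi>\<close>, so only the residues of the multiples of \<open>\<pi> / q\<close> modulo
  \<open>q\<close> matter. Those run through a complete residue system, and a shift of it moves \<open>x\<close> into
  \<open>[0, \<pi> / q]\<close>, where all sines are nonnegative. There the sum equals
  \<open>cos (x - h) / sin h\<close> with \<open>h = \<pi> / 2q\<close>, which is smallest at the two end points.
\<close>

lemma sum_abs_sin_ge:
  fixes q :: nat and b :: int
  assumes q: "q \<ge> 2" and b: "coprime b (int q)"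
  shows "(\<Sum>j<q. \<bar>sin (x + pi * of_int b * real j / real q)\<bar>) \<ge> real q * B_const q"
proof -
  define k where "k = \<lfloor>x * real q / pi\<rfloor>"
  define x0 where "x0 = x - pi * of_int k / real q"
  have "of_int k \<le> x * real q / pi" "x * real q / pi < of_int k + 1"
    by (simp_all add: k_def)
  then have "of_int k * pi / real q \<le> x" "x \<le> (of_int k + 1) * pi / real q"
    using q by (simp_all add: field_simps)
  then have x0: "0 \<le> x0" "x0 \<le> pi / real q"
    by (simp_all add: x0_def add_divide_distrib distrib_right distrib_left mult.commute)
  define g where "g = (\<lambda>t::int. \<bar>sin (x0 + pi * of_int t / real q)\<bar>)"
  have g_mod: "g (t mod int q) = g t" for t
  proof -
    have "of_int t = (of_int (t div int q) * real q + of_int (t mod int q) :: real)"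
      by (metis div_mult_mod_eq of_int_add of_int_mult of_int_of_nat_eq)
    then have "x0 + pi * of_int t / real q
        = (x0 + pi * of_int (t mod int q) / real q) + pi * of_int (t div int q)"
      using q by (simp add: field_simps)
    then show ?thesis by (simp only: g_def abs_sin_add_int_pi)
  qed
  have "(\<Sum>j<q. \<bar>sin (x + pi * of_int b * real j / real q)\<bar>) = (\<Sum>j<q. g (b * int j + k))"
    using q by (intro sum.cong refl) (simp add: g_def x0_def field_simps)
  also have "\<dots> = (\<Sum>j\<in>{0..<int q}. g (b * j + k))"
    by (rule sum.reindex_bij_witness[of _ nat int]) auto
  also have "\<dots> = (\<Sum>j\<in>{0..<int q}. g ((b * j + k) mod int q))"
    by (simp add: g_mod)
  also have "\<dots> = (\<Sum>t\<in>{0..<int q}. g t)"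
    using q b by (intro sum.reindex_bij_betw bij_betw_affine_mod) auto
  also have "\<dots> = (\<Sum>l<q. g (int l))"
    by (rule sum.reindex_bij_witness[of _ int nat]) auto
  also have "\<dots> = (\<Sum>l<q. sin (x0 + pi * real l / real q))"
    \<comment> \<open>All the arguments lie in \<open>[0, \<pi>]\<close>.\<close>
  proof (intro sum.cong refl)
    fix l assume "l \<in> {..<q}"
    then have "real l + 1 \<le> real q" by auto
    then have "pi * (real l + 1) / real q \<le> pi"
      using q by (simp add: pos_divide_le_eq)
    then have "x0 + pi * real l / real q \<le> pi"
      using x0(2) by (simp add: distrib_left add_divide_distrib)
    then have "sin (x0 + pi * real l / real q) \<ge> 0"
      using x0(1) by (intro sin_ge_zero) auto
    then show "g (int l) = sin (x0 + pi * real l / real q)"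
      by (simp add: g_def)
  qed
  finally have sum_eq: "(\<Sum>j<q. \<bar>sin (x + pi * of_int b * real j / real q)\<bar>)
      = (\<Sum>l<q. sin (x0 + pi * real l / real q))" .
  define h where "h = pi / (2 * real q)"
  have h: "0 < h" "h < pi / 2" "pi / real q = 2 * h"
    using q by (auto simp: h_def field_simps)
  then have "sin h > 0" by (auto intro!: sin_gt_zero)
  have "cos h \<le> cos \<bar>x0 - h\<bar>"
    using x0 h by (intro cos_monotone_0_pi_le) auto
  also have "\<dots> = sin h * (\<Sum>l<q. sin (x0 + pi * real l / real q))"
    using sum_sin_half_period[of q x0] q by (simp add: h_def)
  finally have "cos h / sin h \<le> (\<Sum>l<q. sin (x0 + pi * real l / real q))"
    using \<open>sin h > 0\<close> by (simp add: field_simps)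
  then show ?thesis
    using sum_eq B_const_eq_cot[OF q] by (simp add: h_def cot_def)
qed

text \<open>
  Squaring doubles the phases, so the step is \<open>2 p \<pi> / q\<close>; the oddness of \<open>q\<close> enters because
  \<open>2 p\<close> has to be coprime to \<open>q\<close>.
\<close>

lemma sum_abs_Im_rotated_square_ge:
  fixes q p :: nat
  assumes q: "q \<ge> 2" "odd q" and p: "coprime p q"
  shows "(\<Sum>j<q. \<bar>Im ((cis (real (Suc j) * (pi * real p / real q)) * z)\<^sup>2)\<bar>)
         \<ge> real q * B_const q * (cmod z)\<^sup>2"
proof -
  define w where "w = pi * real p / real q"
  define x where "x = 2 * w + 2 * Arg z"
  have "\<bar>Im ((cis (real (Suc j) * w) * z)\<^sup>2)\<bar>
      = (cmod z)\<^sup>2 * \<bar>sin (x + pi * of_int (2 * int p) * real j / real q)\<bar>" for j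
  proof -
    have "(cis (real (Suc j) * w) * z)\<^sup>2 = (rcis (cmod z) (real (Suc j) * w + Arg z))\<^sup>2"
      by (subst (1) rcis_cmod_Arg[of z, symmetric]) (simp only: rcis_def mult.left_commute cis_mult)
    also have "\<dots> = rcis ((cmod z)\<^sup>2) (2 * (real (Suc j) * w + Arg z))"
      by (simp add: DeMoivre2)
    also have "2 * (real (Suc j) * w + Arg z) = x + pi * of_int (2 * int p) * real j / real q"
      by (simp add: x_def w_def algebra_simps add_divide_distrib)
    finally show ?thesis by (simp add: abs_mult)
  qed
  then have "(\<Sum>j<q. \<bar>Im ((cis (real (Suc j) * w) * z)\<^sup>2)\<bar>)
      = (cmod z)\<^sup>2 * (\<Sum>j<q. \<bar>sin (x + pi * of_int (2 * int p) * real j / real q)\<bar>)"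
    by (simp add: sum_distrib_left)
  moreover have "coprime (2 * int p) (int q)"
    using q p by (simp add: coprime_left_2_iff_odd)
  ultimately show ?thesis
    using mult_left_mono[OF sum_abs_sin_ge[OF q(1), of "2 * int p" x], of "(cmod z)\<^sup>2"]
    by (simp add: w_def mult.commute)
qed

section \<open>A Raabe test with step q\<close>

text \<open>
  The hypothesis bounds \<open>\<delta> * s m\<close> by \<open>t m - t (m + q)\<close> with \<open>t m = (m - q) * s m\<close>, and sums of
  such differences telescope to at most \<open>q\<close> terms of \<open>t\<close>.
\<close>

lemma summable_raabe_step:
  fixes s :: "nat \<Rightarrow> real"
  assumes nonneg: "\<And>m. s m \<ge> 0" and "\<delta> > 0"
    and ev: "\<forall>\<^sub>F m in sequentially. real m * s (m + q) \<le> (real m - real q - \<delta>) * s m"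
  shows "summable s"
proof -
  obtain M0 where M0: "\<And>m. m \<ge> M0 \<Longrightarrow> real m * s (m + q) \<le> (real m - real q - \<delta>) * s m"
    using ev by (auto simp: eventually_sequentially)
  \<comment> \<open>Starting beyond \<open>q\<close> keeps the weights \<open>m - q\<close> nonnegative.\<close>
  define M where "M = M0 + q"
  define t where "t = (\<lambda>m. (real (m + M) - real q) * s (m + M))"
  have t_nonneg: "t m \<ge> 0" for m
    using nonneg by (simp add: t_def M_def)
  have decr: "\<delta> * s (m + M) \<le> t m - t (m + q)" for m
    using M0[of "m + M"] by (simp add: t_def M_def algebra_simps)
  have "\<delta> * (\<Sum>m<n. s (m + M)) \<le> (\<Sum>m<q. t m)" for n
  proof -
    have "\<delta> * (\<Sum>m<n. s (m + M)) \<le> (\<Sum>m<n. t m - t (m + q))"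
      unfolding sum_distrib_left by (intro sum_mono decr)
    also have "\<dots> = (\<Sum>m<q. t m) - (\<Sum>m<q. t (m + n))"
    proof (induction n)
      case (Suc n)
      have "(\<Sum>m<q. t (m + n)) + t (n + q) = (\<Sum>m<Suc q. t (m + n))"
        by (simp add: add.commute)
      also have "\<dots> = t n + (\<Sum>m<q. t (m + Suc n))"
        by (subst sum.lessThan_Suc_shift) simp
      finally show ?case using Suc by simp
    qed simp
    also have "\<dots> \<le> (\<Sum>m<q. t m)"
      using t_nonneg by (simp add: sum_nonneg)
    finally show ?thesis .
  qed
  then have "summable (\<lambda>m. s (m + M))"
    using \<open>\<delta> > 0\<close> nonneg
    by (intro summableI_nonneg_bounded[of _ "(\<Sum>m<q. t m) / \<delta>"]) (auto simp: field_simps)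
  then show ?thesis by (simp add: summable_iff_shift)
qed

section \<open>The controlled phasor\<close>

text \<open>
  Unlike \<open>sgn\<close>, this sign never vanishes, so that the potential below has size exactly
  \<open>a / n\<close> at every site.
\<close>

definition sg :: "real \<Rightarrow> real" where
  "sg t = (if t \<ge> 0 then 1 else - 1)"

lemma sg_mult_self: "sg t * t = \<bar>t\<bar>"
  and abs_sg: "\<bar>sg t\<bar> = 1"
  by (auto simp: sg_def)

text \<open>
  For a solution \<open>u\<close> and \<open>c = a / sin \<omega>\<close>, the value at \<open>n\<close> is \<open>u n - cis (-\<omega>) * u (n - 1)\<close>:
  a rotation by \<open>\<omega>\<close> is followed by a shear whose sign is chosen to decrease the modulus. The
  step out of \<open>0\<close> is a pure rotation, because \<open>c / 0 = 0\<close>; this lets the recursion begin one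
  site before the potential does.
\<close>

primrec phasor :: "real \<Rightarrow> real \<Rightarrow> complex \<Rightarrow> nat \<Rightarrow> complex" where
  "phasor \<omega> c z0 0 = z0"
| "phasor \<omega> c z0 (Suc n) = (let y = cis \<omega> * phasor \<omega> c z0 n
     in y - of_real (c / real n * sg (Im (y\<^sup>2)) * Im y))"

lemma norm_phasor_Suc_diff:
  assumes "c \<ge> 0"
  shows "cmod (phasor \<omega> c z0 (Suc n) - cis \<omega> * phasor \<omega> c z0 n)
           \<le> c / real n * cmod (phasor \<omega> c z0 n)"
proof -
  define y where "y = cis \<omega> * phasor \<omega> c z0 n"
  have "\<bar>Im y\<bar> \<le> cmod (phasor \<omega> c z0 n)"
    using abs_Im_le_cmod[of y] by (simp add: y_def norm_mult)
  then have "c / real n * \<bar>Im y\<bar> \<le> c / real n * cmod (phasor \<omega> c z0 n)"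
    using assms by (intro mult_left_mono) auto
  then show ?thesis
    using assms by (simp add: Let_def y_def[symmetric] norm_mult abs_mult abs_sg flip: of_real_mult of_real_divide)
qed

text \<open>
  For a rotated vector \<open>y\<close>, the cross term in \<open>\<bar>y - v Im y\<bar>\<^sup>2\<close> is
  \<open>- 2 v Re y Im y = - v Im (y\<^sup>2)\<close>, and the sign contained in \<open>v\<close> makes it nonpositive.
\<close>

lemma norm_phasor_Suc_sq:
  assumes "c \<ge> 0"
  shows "(cmod (phasor \<omega> c z0 (Suc n)))\<^sup>2 \<le> (cmod (phasor \<omega> c z0 n))\<^sup>2
     - c / real n * \<bar>Im ((cis \<omega> * phasor \<omega> c z0 n)\<^sup>2)\<bar>
     + (c / real n)\<^sup>2 * (cmod (phasor \<omega> c z0 n))\<^sup>2"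
proof -
  define y where "y = cis \<omega> * phasor \<omega> c z0 n"
  define e where "e = c / real n"
  define \<sigma> where "\<sigma> = sg (Im (y\<^sup>2))"
  have ny: "cmod y = cmod (phasor \<omega> c z0 n)" by (simp add: y_def norm_mult)
  have s2: "\<sigma>\<^sup>2 = 1" by (simp add: \<sigma>_def sg_def)
  have "(cmod (phasor \<omega> c z0 (Suc n)))\<^sup>2 = (Re y - e * \<sigma> * Im y)\<^sup>2 + (Im y)\<^sup>2"
    by (simp add: Let_def y_def[symmetric] e_def[symmetric] \<sigma>_def[symmetric] cmod_power2)
  also have "\<dots> = (cmod y)\<^sup>2 - e * (\<sigma> * Im (y\<^sup>2)) + e\<^sup>2 * \<sigma>\<^sup>2 * (Im y)\<^sup>2"
    unfolding cmod_power2 by (simp add: power2_eq_square algebra_simps)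
  also have "\<dots> = (cmod y)\<^sup>2 - e * \<bar>Im (y\<^sup>2)\<bar> + e\<^sup>2 * (Im y)\<^sup>2"
    by (simp add: s2) (simp add: \<sigma>_def sg_mult_self)
  also have "\<dots> \<le> (cmod y)\<^sup>2 - e * \<bar>Im (y\<^sup>2)\<bar> + e\<^sup>2 * (cmod y)\<^sup>2"
    by (simp add: cmod_power2 mult_left_mono)
  finally show ?thesis unfolding ny by (simp only: e_def y_def)
qed

lemma phasor_free_approx:
  assumes "c \<ge> 0"
  shows "\<exists>K\<ge>0. \<forall>m\<ge>1. cmod (phasor \<omega> c z0 (m + j) - cis (real j * \<omega>) * phasor \<omega> c z0 m)
           \<le> K / real m * cmod (phasor \<omega> c z0 m)"
proof (induction j)
  case 0
  then show ?case by (intro exI[of _ 0]) auto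
next
  case (Suc j)
  let ?z = "phasor \<omega> c z0"
  obtain K where K: "K \<ge> 0"
    "\<And>m. m \<ge> 1 \<Longrightarrow> cmod (?z (m + j) - cis (real j * \<omega>) * ?z m) \<le> K / real m * cmod (?z m)"
    using Suc by blast
  show ?case
  proof (intro exI[of _ "K + c * (1 + K)"] conjI allI impI)
    show "0 \<le> K + c * (1 + K)" using K assms by simp
    fix m :: nat assume m: "m \<ge> 1"
    have "K / real m * cmod (?z m) \<le> K * cmod (?z m)"
      using m K(1) by (intro mult_right_mono) (auto simp: field_simps mult_le_cancel_left1)
    moreover have "cmod (?z (m + j)) \<le> cmod (cis (real j * \<omega>) * ?z m) + K / real m * cmod (?z m)"
      using K(2)[OF m] norm_triangle_sub[of "?z (m + j)" "cis (real j * \<omega>) * ?z m"] by linarith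
    ultimately have bd: "cmod (?z (m + j)) \<le> (1 + K) * cmod (?z m)"
      by (simp add: norm_mult algebra_simps)
    have "?z (m + Suc j) - cis (real (Suc j) * \<omega>) * ?z m
        = (?z (Suc (m + j)) - cis \<omega> * ?z (m + j))
          + cis \<omega> * (?z (m + j) - cis (real j * \<omega>) * ?z m)"
      by (simp add: algebra_simps cis_mult[symmetric] del: phasor.simps)
    then have "cmod (?z (m + Suc j) - cis (real (Suc j) * \<omega>) * ?z m)
        \<le> cmod (?z (Suc (m + j)) - cis \<omega> * ?z (m + j))
          + cmod (cis \<omega> * (?z (m + j) - cis (real j * \<omega>) * ?z m))"
      by (metis norm_triangle_ineq)
    also have "\<dots> \<le> c / real (m + j) * cmod (?z (m + j)) + K / real m * cmod (?z m)"
      using norm_phasor_Suc_diff[OF assms, of \<omega> z0 "m + j"] K(2)[OF m]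
      by (simp add: norm_mult del: phasor.simps)
    also have "\<dots> \<le> c / real m * ((1 + K) * cmod (?z m)) + K / real m * cmod (?z m)"
      using m assms bd K(1) by (intro add_right_mono mult_mono divide_left_mono) auto
    also have "\<dots> = (K + c * (1 + K)) / real m * cmod (?z m)"
      by (simp add: algebra_simps add_divide_distrib)
    finally show "cmod (?z (m + Suc j) - cis (real (Suc j) * \<omega>) * ?z m)
        \<le> (K + c * (1 + K)) / real m * cmod (?z m)" .
  qed
qed

text \<open>
  In the loss at site \<open>m + j\<close>, replacing \<open>1 / (m + j)\<close> by \<open>1 / m\<close> and the current vector by the
  freely rotated one each causes a relative error of
  \<open>O(1 / m)\<close> (relative to \<open>\<bar>z m\<bar>\<^sup>2\<close> in the case of the vector). As the loss itself is
  \<open>O(1 / m)\<close>, both errors are of second order, like the quadratic term of the shear.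
\<close>

lemma phasor_single_loss:
  assumes c: "c \<ge> 0"
  shows "\<exists>C\<ge>0. \<forall>m\<ge>1. (cmod (phasor \<omega> c z0 (m + Suc j)))\<^sup>2 \<le> (cmod (phasor \<omega> c z0 (m + j)))\<^sup>2
     - c / real m * \<bar>Im ((cis (real (Suc j) * \<omega>) * phasor \<omega> c z0 m)\<^sup>2)\<bar>
     + C / (real m)\<^sup>2 * (cmod (phasor \<omega> c z0 m))\<^sup>2"
proof -
  let ?z = "phasor \<omega> c z0"
  obtain K where K: "K \<ge> 0"
    "\<And>m. m \<ge> 1 \<Longrightarrow> cmod (?z (m + j) - cis (real j * \<omega>) * ?z m) \<le> K / real m * cmod (?z m)"
    using phasor_free_approx[OF c] by blast
  \<comment> \<open>The three summands come from \<open>1 / (m + j)\<close>, the rotated vector, and the quadratic term.\<close>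
  define C where "C = c * real j + c * (K * (2 + K)) + c\<^sup>2 * (1 + K)\<^sup>2"
  show ?thesis
  proof (intro exI[of _ C] conjI allI impI)
    show "C \<ge> 0" using K c by (simp add: C_def)
    fix m :: nat assume m: "m \<ge> 1"
    define S where "S = cmod (?z m)"
    define y where "y = cis \<omega> * ?z (m + j)"
    define Y where "Y = cis (real (Suc j) * \<omega>) * ?z m"
    have S0: "S \<ge> 0" by (simp add: S_def)
    have nY: "cmod Y = S" by (simp add: Y_def norm_mult S_def)
    have "Y = cis \<omega> * (cis (real j * \<omega>) * ?z m)"
      by (simp add: Y_def algebra_simps cis_mult[symmetric])
    then have "y - Y = cis \<omega> * (?z (m + j) - cis (real j * \<omega>) * ?z m)"
      by (simp add: y_def algebra_simps)
    then have dist: "cmod (y - Y) \<le> K / real m * S"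
      using K(2)[OF m] by (simp add: norm_mult S_def)
    also have "\<dots> \<le> K * S"
      using m K(1) S0 by (intro mult_right_mono) (auto simp: field_simps mult_le_cancel_left1)
    finally have distK: "cmod (y - Y) \<le> K * S" .
    have ny: "cmod y = cmod (?z (m + j))" by (simp add: y_def norm_mult)
    have y_le: "cmod y \<le> (1 + K) * S"
      using norm_triangle_sub[of y Y] distK nY by (simp add: algebra_simps)
    have "cmod (y\<^sup>2 - Y\<^sup>2) = cmod (y - Y) * cmod (y + Y)"
      by (simp add: norm_mult[symmetric] power2_eq_square algebra_simps)
    also have "\<dots> \<le> (K / real m * S) * ((2 + K) * S)"
      using dist norm_triangle_ineq[of y Y] y_le nY S0 K(1)
      by (intro mult_mono) (auto simp: algebra_simps)
    finally have sqdiff: "cmod (y\<^sup>2 - Y\<^sup>2) \<le> K * (2 + K) / real m * S\<^sup>2"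
      by (simp add: power2_eq_square algebra_simps add_divide_distrib)
    have "\<bar>Im (Y\<^sup>2)\<bar> - \<bar>Im (y\<^sup>2)\<bar> \<le> cmod (y\<^sup>2 - Y\<^sup>2)"
      using abs_Im_le_cmod[of "y\<^sup>2 - Y\<^sup>2"] by simp
    with sqdiff have low: "\<bar>Im (y\<^sup>2)\<bar> \<ge> \<bar>Im (Y\<^sup>2)\<bar> - K * (2 + K) / real m * S\<^sup>2"
      by linarith
    have ImY: "\<bar>Im (Y\<^sup>2)\<bar> \<le> S\<^sup>2"
      using abs_Im_le_cmod[of "Y\<^sup>2"] by (simp add: norm_power nY)
    have rec: "c / real m - c * real j / (real m)\<^sup>2 \<le> c / real (m + j)"
    proof -
      have "1 / real m - real j / (real m)\<^sup>2 \<le> 1 / real (m + j)"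
        using m by (simp add: field_simps power2_eq_square)
      then have "c * (1 / real m - real j / (real m)\<^sup>2) \<le> c * (1 / real (m + j))"
        using c by (rule mult_left_mono)
      then show ?thesis by (simp add: right_diff_distrib)
    qed
    have le_m: "c / real (m + j) \<le> c / real m"
      using m c by (intro divide_left_mono) auto
    have main: "c / real (m + j) * \<bar>Im (y\<^sup>2)\<bar> \<ge> c / real m * \<bar>Im (Y\<^sup>2)\<bar>
        - (c * real j + c * (K * (2 + K))) / (real m)\<^sup>2 * S\<^sup>2"
    proof -
      have "c / real m * \<bar>Im (Y\<^sup>2)\<bar> - c * real j / (real m)\<^sup>2 * S\<^sup>2
          \<le> (c / real m - c * real j / (real m)\<^sup>2) * \<bar>Im (Y\<^sup>2)\<bar>"
        using mult_left_mono[OF ImY, of "c * real j / (real m)\<^sup>2"] c by (simp add: left_diff_distrib)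
      also have "\<dots> \<le> c / real (m + j) * \<bar>Im (Y\<^sup>2)\<bar>"
        by (intro mult_right_mono rec) auto
      also have "\<dots> \<le> c / real (m + j) * (\<bar>Im (y\<^sup>2)\<bar> + K * (2 + K) / real m * S\<^sup>2)"
        using low c by (intro mult_left_mono) auto
      also have "\<dots> = c / real (m + j) * \<bar>Im (y\<^sup>2)\<bar> + c / real (m + j) * (K * (2 + K) / real m * S\<^sup>2)"
        by (rule distrib_left)
      also have "\<dots> \<le> c / real (m + j) * \<bar>Im (y\<^sup>2)\<bar> + c / real m * (K * (2 + K) / real m * S\<^sup>2)"
        using le_m K(1) by (intro add_left_mono mult_right_mono) auto
      finally show ?thesis
        by (simp add: power2_eq_square add_divide_distrib algebra_simps)
    qed
    have quad: "(c / real (m + j))\<^sup>2 * (cmod y)\<^sup>2 \<le> c\<^sup>2 * (1 + K)\<^sup>2 / (real m)\<^sup>2 * S\<^sup>2"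
    proof -
      have "(c / real (m + j))\<^sup>2 * (cmod y)\<^sup>2 \<le> (c / real m)\<^sup>2 * ((1 + K) * S)\<^sup>2"
        using le_m y_le c by (intro mult_mono power_mono) auto
      then show ?thesis by (simp add: power_mult_distrib power_divide)
    qed
    have "(cmod (?z (m + Suc j)))\<^sup>2 \<le> (cmod (?z (m + j)))\<^sup>2
        - c / real (m + j) * \<bar>Im (y\<^sup>2)\<bar> + (c / real (m + j))\<^sup>2 * (cmod y)\<^sup>2"
      using norm_phasor_Suc_sq[OF c, of \<omega> z0 "m + j"]
      by (simp add: ny y_def[symmetric] del: phasor.simps)
    also have "\<dots> \<le> (cmod (?z (m + j)))\<^sup>2 - c / real m * \<bar>Im (Y\<^sup>2)\<bar> + C / (real m)\<^sup>2 * S\<^sup>2"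
      using main quad by (simp add: C_def add_divide_distrib distrib_right)
    finally show "(cmod (?z (m + Suc j)))\<^sup>2 \<le> (cmod (?z (m + j)))\<^sup>2
        - c / real m * \<bar>Im ((cis (real (Suc j) * \<omega>) * ?z m)\<^sup>2)\<bar>
        + C / (real m)\<^sup>2 * (cmod (?z m))\<^sup>2"
      by (simp only: Y_def S_def)
  qed
qed

lemma phasor_block_loss:
  assumes c: "c \<ge> 0"
  shows "\<exists>C\<ge>0. \<forall>m\<ge>1. (cmod (phasor \<omega> c z0 (m + j)))\<^sup>2 \<le> (cmod (phasor \<omega> c z0 m))\<^sup>2
     - c / real m * (\<Sum>i<j. \<bar>Im ((cis (real (Suc i) * \<omega>) * phasor \<omega> c z0 m)\<^sup>2)\<bar>)
     + C / (real m)\<^sup>2 * (cmod (phasor \<omega> c z0 m))\<^sup>2"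
proof (induction j)
  case 0
  then show ?case by (intro exI[of _ 0]) auto
next
  case (Suc j)
  obtain C where C: "C \<ge> 0"
    "\<And>m. m \<ge> 1 \<Longrightarrow> (cmod (phasor \<omega> c z0 (m + j)))\<^sup>2 \<le> (cmod (phasor \<omega> c z0 m))\<^sup>2
     - c / real m * (\<Sum>i<j. \<bar>Im ((cis (real (Suc i) * \<omega>) * phasor \<omega> c z0 m)\<^sup>2)\<bar>)
     + C / (real m)\<^sup>2 * (cmod (phasor \<omega> c z0 m))\<^sup>2"
    using Suc by blast
  obtain D where D: "D \<ge> 0"
    "\<And>m. m \<ge> 1 \<Longrightarrow> (cmod (phasor \<omega> c z0 (m + Suc j)))\<^sup>2 \<le> (cmod (phasor \<omega> c z0 (m + j)))\<^sup>2
     - c / real m * \<bar>Im ((cis (real (Suc j) * \<omega>) * phasor \<omega> c z0 m)\<^sup>2)\<bar>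
     + D / (real m)\<^sup>2 * (cmod (phasor \<omega> c z0 m))\<^sup>2"
    using phasor_single_loss[OF c] by blast
  show ?case
  proof (intro exI[of _ "C + D"] conjI allI impI)
    show "0 \<le> C + D" using C D by simp
    fix m :: nat assume m: "m \<ge> 1"
    show "(cmod (phasor \<omega> c z0 (m + Suc j)))\<^sup>2 \<le> (cmod (phasor \<omega> c z0 m))\<^sup>2
     - c / real m * (\<Sum>i<Suc j. \<bar>Im ((cis (real (Suc i) * \<omega>) * phasor \<omega> c z0 m)\<^sup>2)\<bar>)
     + (C + D) / (real m)\<^sup>2 * (cmod (phasor \<omega> c z0 m))\<^sup>2"
      using C(2)[OF m] D(2)[OF m]
      unfolding sum.lessThan_Suc distrib_left add_divide_distrib distrib_right by linarith
  qed
qed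

text \<open>
  One block of \<open>q\<close> steps loses at least the fraction \<open>q \<gamma> / m\<close> with \<open>\<gamma> = c B\<close>. Half of the
  surplus \<open>q (\<gamma> - 1)\<close> absorbs the second-order error, and the other half remains for the
  Raabe test.
\<close>

lemma summable_phasor:
  fixes p q :: nat
  assumes q: "q \<ge> 2" "odd q" and p: "coprime p q" and cB: "c * B_const q > 1"
  shows "summable (\<lambda>n. (cmod (phasor (pi * real p / real q) c z0 n))\<^sup>2)"
proof -
  define \<omega> where "\<omega> = pi * real p / real q"
  define s where "s = (\<lambda>n. (cmod (phasor \<omega> c z0 n))\<^sup>2)"
  have "c > 0"
    using cB B_const_pos[OF q(1)] by (smt (verit) mult_nonpos_nonneg)
  obtain C where C: "C \<ge> 0"
    "\<And>m. m \<ge> 1 \<Longrightarrow> s (m + q) \<le> s m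
     - c / real m * (\<Sum>i<q. \<bar>Im ((cis (real (Suc i) * \<omega>) * phasor \<omega> c z0 m)\<^sup>2)\<bar>)
     + C / (real m)\<^sup>2 * s m"
    using phasor_block_loss[of c \<omega> z0 q] \<open>c > 0\<close> unfolding s_def by fastforce
  define \<gamma> where "\<gamma> = c * B_const q"
  define \<delta> where "\<delta> = real q * (\<gamma> - 1) / 2"
  have "\<delta> > 0" using cB q by (simp add: \<delta>_def \<gamma>_def)
  have "summable s"
  proof (rule summable_raabe_step[OF _ \<open>\<delta> > 0\<close>])
    show "s m \<ge> 0" for m by (simp add: s_def)
    have "(\<lambda>m. C / real m) \<longlonglongrightarrow> 0" by (rule lim_const_over_n)
    then have "\<forall>\<^sub>F m in sequentially. C / real m < \<delta>"
      using \<open>\<delta> > 0\<close> by (rule order_tendstoD)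
    with eventually_ge_at_top[of 1]
    show "\<forall>\<^sub>F m in sequentially. real m * s (m + q) \<le> (real m - real q - \<delta>) * s m"
    proof eventually_elim
      case (elim m)
      have "c / real m * (real q * B_const q * s m)
          \<le> c / real m * (\<Sum>i<q. \<bar>Im ((cis (real (Suc i) * \<omega>) * phasor \<omega> c z0 m)\<^sup>2)\<bar>)"
        using sum_abs_Im_rotated_square_ge[OF q p, of "phasor \<omega> c z0 m"] \<open>c > 0\<close>
        by (intro mult_left_mono) (auto simp: \<omega>_def s_def)
      with C(2)[of m] elim(1)
      have "s (m + q) \<le> s m - c / real m * (real q * B_const q * s m) + C / (real m)\<^sup>2 * s m"
        by linarith
      then have "real m * s (m + q)
          \<le> real m * (s m - c / real m * (real q * B_const q * s m) + C / (real m)\<^sup>2 * s m)"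
        by (intro mult_left_mono) auto
      also have "\<dots> = (real m - real q * \<gamma> + C / real m) * s m"
        using elim(1) by (simp add: \<gamma>_def field_simps power2_eq_square)
      also have "\<dots> \<le> (real m - real q * \<gamma> + \<delta>) * s m"
        using elim(2) by (intro mult_right_mono) (auto simp: s_def)
      also have "real m - real q * \<gamma> + \<delta> = real m - real q - \<delta>"
        by (simp add: \<delta>_def algebra_simps)
      finally show ?case .
    qed
  qed
  then show ?thesis by (simp add: s_def \<omega>_def)
qed

section \<open>The eigenfunction\<close>

text \<open>
  With \<open>y n = cis \<omega> * z n\<close>, the shear subtracts a real number, so \<open>Im (z n) = Im (y (n - 1))\<close>:
  the previous value of \<open>u\<close> is read off by rotating back. The next one is read off by rotating
  forward, and the two rotations add up to \<open>2 cos \<omega>\<close>.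
\<close>

lemma phasor_solves_schroedinger:
  fixes \<omega> a :: real and z0 :: complex
  defines "z \<equiv> phasor \<omega> (a / sin \<omega>) z0"
  defines "V \<equiv> \<lambda>n. a / real n * sg (Im ((cis \<omega> * z n)\<^sup>2))"
    and "u \<equiv> \<lambda>n. complex_of_real (Im (cis \<omega> * z n) / sin \<omega>)"
  assumes "sin \<omega> \<noteq> 0" and "n \<ge> 1"
  shows "schroedinger V u n = of_real (2 * cos \<omega>) * u n"
proof -
  define y where "y = (\<lambda>n. cis \<omega> * z n)"
  have z_Suc: "z (Suc n) = y n - of_real (V n / sin \<omega> * Im (y n))" for n
    by (simp add: z_def V_def y_def Let_def)
  obtain m where n: "n = Suc m" using \<open>n \<ge> 1\<close> by (cases n) auto
  have prev: "Im (y m) = Im (cis (- \<omega>) * y n)"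
  proof -
    have "cis (- \<omega>) * y n = z n"
      by (simp add: y_def mult.assoc[symmetric] cis_mult)
    then show ?thesis by (simp add: n z_Suc)
  qed
  have succ: "Im (y (Suc n)) = Im (cis \<omega> * y n) - V n * Im (y n)"
  proof -
    have "y (Suc n) = cis \<omega> * y n - cis \<omega> * of_real (V n / sin \<omega> * Im (y n))"
      by (simp only: y_def z_Suc right_diff_distrib)
    then show ?thesis using \<open>sin \<omega> \<noteq> 0\<close> by simp
  qed
  have "Im (y (Suc n)) + Im (y m) + V n * Im (y n) = 2 * cos \<omega> * Im (y n)"
    unfolding prev succ by (simp add: algebra_simps)
  then have "Im (y (Suc n)) / sin \<omega> + Im (y m) / sin \<omega> + V n * (Im (y n) / sin \<omega>)
      = 2 * cos \<omega> * (Im (y n) / sin \<omega>)"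
    by (simp add: add_divide_distrib[symmetric])
  then have "complex_of_real (Im (y (Suc n)) / sin \<omega> + Im (y m) / sin \<omega> + V n * (Im (y n) / sin \<omega>))
      = complex_of_real (2 * cos \<omega> * (Im (y n) / sin \<omega>))"
    by simp
  then show ?thesis
    unfolding schroedinger_def u_def y_def n by simp
qed

lemma S_setD:
  assumes "E \<in> S_set q"
  obtains p where "p \<in> {1..q - 1}" "coprime p q" "E = 2 * cos (pi * real p / real q)"
proof -
  obtain p where E: "-2 < E" "E < 2" and p: "p \<in> {1..q - 1}" "coprime p q"
    "quasimomentum E = real p / real q"
    using assms by (auto simp: S_set_def)
  have "E = 2 * cos (pi * quasimomentum E)"
    using theI'[OF quasimomentum_unique[OF E]] unfolding quasimomentum_def by blast
  with p that show thesis by simp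
qed

lemma sin_less_of_E_tilde_less:
  assumes "q \<ge> 2" "0 < a" "a < 1 / B_const q" "0 < sin \<omega>"
    and "E_tilde a q < \<bar>2 * cos \<omega>\<bar>"
  shows "sin \<omega> < a * B_const q"
proof -
  have B: "B_const q > 0" by (rule B_const_pos[OF assms(1)])
  then have "a * B_const q < 1" "0 < a * B_const q" using assms by (simp_all add: field_simps)
  then have le1: "(a * B_const q)\<^sup>2 \<le> 1"
    by (simp add: power_le_one)
  have "sqrt (1 - (a * B_const q)\<^sup>2) < \<bar>cos \<omega>\<bar>"
    using assms(5) by (simp add: E_tilde_def power_mult_distrib abs_mult)
  then have "(sqrt (1 - (a * B_const q)\<^sup>2))\<^sup>2 < \<bar>cos \<omega>\<bar>\<^sup>2"
    using le1 by (intro power_strict_mono) auto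
  then have "(sin \<omega>)\<^sup>2 < (a * B_const q)\<^sup>2"
    using le1 by (simp add: cos_squared_eq)
  then show ?thesis
    using \<open>0 < a * B_const q\<close> by (auto intro: power_less_imp_less_base)
qed

theorem theorem2p8:
  fixes q :: nat and a E \<theta> :: real
  assumes "q \<ge> 3" and "odd q"
    and "0 < a" and "a < 1 / B_const q"
    and "E \<in> S_set q"
    and "E \<in> {-2<..<- E_tilde a q} \<union> {E_tilde a q<..<2}"
    and "\<theta> \<in> {0..pi}"
  shows "\<exists>V :: nat \<Rightarrow> real.
           limsup (\<lambda>n. ereal \<bar>real n * V n\<bar>) = ereal a \<and> is_eigenvalue V \<theta> E"
proof -
  obtain p where p: "p \<in> {1..q - 1}" "coprime p q" and E: "E = 2 * cos (pi * real p / real q)"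
    using S_setD[OF assms(5)] .
  define \<omega> where "\<omega> = pi * real p / real q"
  have "0 < \<omega>" "\<omega> < pi"
    using p(1) assms(1) by (auto simp: \<omega>_def field_simps)
  then have sin_pos: "sin \<omega> > 0" by (rule sin_gt_zero)
  have "E_tilde a q < \<bar>2 * cos \<omega>\<bar>"
    using assms(6) by (auto simp: E \<omega>_def abs_if)
  then have "sin \<omega> < a * B_const q"
    using assms sin_pos by (intro sin_less_of_E_tilde_less) auto
  then have decay: "a / sin \<omega> * B_const q > 1"
    using sin_pos by (simp add: field_simps)

  \<comment> \<open>This start makes \<open>z 1 = u 1 - cis (-\<omega>) * u 0\<close> for \<open>u 0 = cos \<theta>\<close> and \<open>u 1 = sin \<theta>\<close>.\<close>
  define z0 where "z0 = cis (- \<omega>) * (of_real (sin \<theta>) - cis (- \<omega>) * of_real (cos \<theta>))"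
  define z where "z = phasor \<omega> (a / sin \<omega>) z0"
  define V where "V = (\<lambda>n. a / real n * sg (Im ((cis \<omega> * z n)\<^sup>2)))"
  define u where "u = (\<lambda>n. complex_of_real (Im (cis \<omega> * z n) / sin \<omega>))"

  have rot_z0: "cis \<omega> * z 0 = of_real (sin \<theta>) - cis (- \<omega>) * of_real (cos \<theta>)"
    by (simp add: z_def z0_def mult.assoc[symmetric] cis_mult)
  have z1: "z 1 = of_real (sin \<theta>) - cis (- \<omega>) * of_real (cos \<theta>)"
    using rot_z0 by (simp add: z_def Let_def)
  have u0: "u 0 = of_real (cos \<theta>)"
    unfolding u_def rot_z0 using sin_pos by simp
  have rot_z1: "cis \<omega> * z 1 = cis \<omega> * of_real (sin \<theta>) - of_real (cos \<theta>)"
    unfolding z1 by (simp add: right_diff_distrib mult.assoc[symmetric] cis_mult)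
  have u1: "u 1 = of_real (sin \<theta>)"
    unfolding u_def rot_z1 using sin_pos by simp

  have "summable (\<lambda>n. (cmod (z n))\<^sup>2)"
    using assms p(2) decay unfolding z_def \<omega>_def by (intro summable_phasor) auto
  then have "summable (\<lambda>n. (cmod (z n))\<^sup>2 / (sin \<omega>)\<^sup>2)"
    by (rule summable_divide)
  moreover have "(cmod (u n))\<^sup>2 \<le> (cmod (z n))\<^sup>2 / (sin \<omega>)\<^sup>2" for n
  proof -
    have "\<bar>Im (cis \<omega> * z n)\<bar> \<le> cmod (z n)"
      using abs_Im_le_cmod[of "cis \<omega> * z n"] by (simp add: norm_mult)
    then have "\<bar>Im (cis \<omega> * z n)\<bar>\<^sup>2 \<le> (cmod (z n))\<^sup>2"
      by (intro power_mono) auto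
    then show ?thesis
      unfolding u_def norm_of_real power2_abs power_divide by (intro divide_right_mono) auto
  qed
  ultimately have "summable (\<lambda>n. (cmod (u n))\<^sup>2)"
    by - (rule summable_comparison_test'[where N = 0], assumption, simp)
  then have "(\<lambda>n. (cmod (u n))\<^sup>2) summable_on UNIV"
    by (simp add: summable_on_UNIV_nonneg_real_iff)
  then have sq: "square_summable u"
    unfolding square_summable_def by (rule summable_on_subset_banach) simp

  have "is_eigenvalue V \<theta> E"
    unfolding is_eigenvalue_def
  proof (intro exI[of _ u] conjI allI impI)
    show "\<exists>n. u n \<noteq> 0"
    proof (cases "cos \<theta> = 0")
      case True
      then have "sin \<theta> \<noteq> 0"
        using sin_cos_squared_add[of \<theta>] by auto
      then have "u 1 \<noteq> 0" unfolding u1 by simp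
      then show ?thesis by blast
    next
      case False
      then have "u 0 \<noteq> 0" unfolding u0 by simp
      then show ?thesis by blast
    qed
    show "schroedinger V u n = of_real E * u n" if "n \<ge> 1" for n
      using phasor_solves_schroedinger[of \<omega> n a z0] sin_pos that
      unfolding V_def u_def z_def E \<omega>_def[symmetric] by simp
    show "boundary_condition \<theta> u"
      by (simp add: boundary_condition_def u0 u1[simplified] mult.commute)
    show "square_summable u" by (rule sq)
  qed
  moreover have "limsup (\<lambda>n. ereal \<bar>real n * V n\<bar>) = ereal a"
  proof (rule lim_imp_Limsup)
    have "\<forall>\<^sub>F n in sequentially. ereal a = ereal \<bar>real n * V n\<bar>"
      using eventually_gt_at_top[of 0]
      by eventually_elim (use \<open>0 < a\<close> in \<open>simp add: V_def abs_mult abs_sg\<close>)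
    then show "(\<lambda>n. ereal \<bar>real n * V n\<bar>) \<longlonglongrightarrow> ereal a"
      by (rule Lim_transform_eventually[OF tendsto_const])
  qed simp
  ultimately show ?thesis by blast
qed

end
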